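(* Every regular homomorphic image of a Prüfer ring is a Prüfer ring; that is, if $A$ is a Prüfer ring and $f:A\to B$ is a surjective regular morphism of rings, then $B$ is a Prüfer ring.
   Context: All rings are commutative with identity. $\mathrm{Reg}(A)$ denotes the set of regular elements (non-zero-divisors) of $A$; an ideal is regular if it contains a regular element. A ring is a Prüfer ring if every finitely generated regular ideal is invertible (in its total ring of fractions). A ring morphism $f:A\to B$ is a regular morphism if $f^{-1}(\mathrm{Reg}(B))\subseteq \mathrm{Reg}(A)$. $B$ is a regular homomorphic image of $A$ if there exists a surjective regular morphism $A\to B$. *)

theory Defs
  imports "HOL-Algebra.Ideal_Product" "HOL-Algebra.RingHom" "HOL-Algebra.Module"
begin

section \<open>Regular elements and the total ring of fractions\<close>

text \<open>Rings are not assumed to be nontrivial: \<open>cring\<close> admits the zero ring, in which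
  \<open>\<zero>\<close> is regular.\<close>

definition reg_elems :: "('a, 'm) ring_scheme \<Rightarrow> 'a set" where
  "reg_elems R = {a \<in> carrier R. \<forall>b\<in>carrier R. a \<otimes>\<^bsub>R\<^esub> b = \<zero>\<^bsub>R\<^esub> \<longrightarrow> b = \<zero>\<^bsub>R\<^esub>}"

text \<open>Since denominators are regular, \<open>a/s = b/t\<close> amounts to \<open>at = bs\<close>; the extra factor
  needed for localization at a general multiplicative set is superfluous.\<close>

definition frac_rel :: "('a, 'm) ring_scheme \<Rightarrow> (('a \<times> 'a) \<times> ('a \<times> 'a)) set" where
  "frac_rel R = {((a, s), (b, t)). a \<in> carrier R \<and> s \<in> reg_elems R \<and>
     b \<in> carrier R \<and> t \<in> reg_elems R \<and> a \<otimes>\<^bsub>R\<^esub> t = b \<otimes>\<^bsub>R\<^esub> s}"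

definition frac_class :: "('a, 'm) ring_scheme \<Rightarrow> 'a \<Rightarrow> 'a \<Rightarrow> ('a \<times> 'a) set" where
  "frac_class R a s = frac_rel R `` {(a, s)}"

text \<open>The total ring of fractions, carrying also its structure of \<open>R\<close>-module so that
  \<open>R\<close>-submodules of it can be expressed. The unions range over all representatives and
  collapse to a single class; see \<open>total_frac_mult\<close> and its companions below.\<close>

definition total_frac :: "('a, 'm) ring_scheme \<Rightarrow> ('a, ('a \<times> 'a) set) module" where
  "total_frac R =
     \<lparr>carrier = (carrier R \<times> reg_elems R) // frac_rel R,
      mult = (\<lambda>X Y. \<Union>(a, s)\<in>X. \<Union>(b, t)\<in>Y. frac_class R (a \<otimes>\<^bsub>R\<^esub> b) (s \<otimes>\<^bsub>R\<^esub> t)),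
      one = frac_class R \<one>\<^bsub>R\<^esub> \<one>\<^bsub>R\<^esub>,
      zero = frac_class R \<zero>\<^bsub>R\<^esub> \<one>\<^bsub>R\<^esub>,
      add = (\<lambda>X Y. \<Union>(a, s)\<in>X. \<Union>(b, t)\<in>Y.
               frac_class R ((a \<otimes>\<^bsub>R\<^esub> t) \<oplus>\<^bsub>R\<^esub> (b \<otimes>\<^bsub>R\<^esub> s)) (s \<otimes>\<^bsub>R\<^esub> t)),
      smult = (\<lambda>c X. \<Union>(a, s)\<in>X. frac_class R (c \<otimes>\<^bsub>R\<^esub> a) s)\<rparr>"

definition frac_embed :: "('a, 'm) ring_scheme \<Rightarrow> 'a \<Rightarrow> ('a \<times> 'a) set" where
  "frac_embed R a = frac_class R a \<one>\<^bsub>R\<^esub>"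


section \<open>Invertible ideals and Pruefer rings\<close>

definition regular_ideal :: "'a set \<Rightarrow> ('a, 'm) ring_scheme \<Rightarrow> bool" where
  "regular_ideal I R \<longleftrightarrow> ideal I R \<and> I \<inter> reg_elems R \<noteq> {}"

definition fin_gen_ideal :: "'a set \<Rightarrow> ('a, 'm) ring_scheme \<Rightarrow> bool" where
  "fin_gen_ideal I R \<longleftrightarrow> (\<exists>S\<subseteq>carrier R. finite S \<and> I = Idl\<^bsub>R\<^esub> S)"

text \<open>\<open>I J = R\<close> for some \<open>R\<close>-submodule \<open>J\<close> of the total ring of fractions; \<open>ideal_prod\<close> is the set
  of finite sums of products and makes sense for arbitrary additive subgroups of a ring.\<close>

definition invertible_ideal :: "'a set \<Rightarrow> ('a, 'm) ring_scheme \<Rightarrow> bool" where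
  "invertible_ideal I R \<longleftrightarrow> ideal I R \<and>
     (\<exists>J. submodule J R (total_frac R) \<and>
          (frac_embed R ` I) \<cdot>\<^bsub>total_frac R\<^esub> J = frac_embed R ` carrier R)"

definition pruefer_ring :: "('a, 'm) ring_scheme \<Rightarrow> bool" where
  "pruefer_ring R \<longleftrightarrow> cring R \<and>
     (\<forall>I. fin_gen_ideal I R \<and> regular_ideal I R \<longrightarrow> invertible_ideal I R)"


section \<open>Regular morphisms\<close>

definition regular_morphism ::
  "('a, 'm) ring_scheme \<Rightarrow> ('b, 'n) ring_scheme \<Rightarrow> ('a \<Rightarrow> 'b) \<Rightarrow> bool" where
  "regular_morphism A B f \<longleftrightarrow>
     f \<in> ring_hom A B \<and> {a \<in> carrier A. f a \<in> reg_elems B} \<subseteq> reg_elems A"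

definition regular_hom_image :: "('b, 'n) ring_scheme \<Rightarrow> ('a, 'm) ring_scheme \<Rightarrow> bool" where
  "regular_hom_image B A \<longleftrightarrow> (\<exists>f. regular_morphism A B f \<and> f ` carrier A = carrier B)"


section \<open>The total ring of fractions is a commutative algebra\<close>

context cring
begin

lemma reg_elems_closed: "s \<in> reg_elems R \<Longrightarrow> s \<in> carrier R"
  by (simp add: reg_elems_def)

lemma reg_elems_one: "\<one> \<in> reg_elems R"
  by (simp add: reg_elems_def)

lemma reg_elems_mult:
  assumes "s \<in> reg_elems R" "t \<in> reg_elems R" shows "s \<otimes> t \<in> reg_elems R"
proof -
  have "b = \<zero>" if "b \<in> carrier R" "s \<otimes> t \<otimes> b = \<zero>" for b
  proof -
    have "s \<otimes> (t \<otimes> b) = \<zero>" "t \<otimes> b \<in> carrier R"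
      using that assms by (simp_all add: reg_elems_closed m_assoc)
    then have "t \<otimes> b = \<zero>" using assms(1) unfolding reg_elems_def by blast
    then show ?thesis using assms(2) that(1) unfolding reg_elems_def by blast
  qed
  moreover have "s \<otimes> t \<in> carrier R" using assms by (simp add: reg_elems_closed)
  ultimately show ?thesis unfolding reg_elems_def by blast
qed

lemma reg_elems_cancel:
  assumes s: "s \<in> reg_elems R" and a: "a \<in> carrier R" and b: "b \<in> carrier R"
    and eq: "s \<otimes> a = s \<otimes> b"
  shows "a = b"
proof -
  have sc: "s \<in> carrier R" using s by (rule reg_elems_closed)
  have "s \<otimes> (a \<ominus> b) = s \<otimes> a \<ominus> s \<otimes> b"
    using sc a b by algebra
  also have "\<dots> = \<zero>" unfolding eq using sc b by (simp add: minus_eq r_neg)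
  finally have "s \<otimes> (a \<ominus> b) = \<zero>" .
  then have "a \<ominus> b = \<zero>" using s a b minus_closed unfolding reg_elems_def by blast
  moreover have "a = (a \<ominus> b) \<oplus> b" using a b by algebra
  ultimately show ?thesis using b by simp
qed

lemma frac_rel_equiv: "equiv (carrier R \<times> reg_elems R) (frac_rel R)"
proof (rule equivI)
  show "frac_rel R \<subseteq> (carrier R \<times> reg_elems R) \<times> (carrier R \<times> reg_elems R)"
    by (auto simp: frac_rel_def)
  show "refl_on (carrier R \<times> reg_elems R) (frac_rel R)"
    by (auto simp: refl_on_def frac_rel_def)
  show "sym (frac_rel R)"
    by (auto simp: sym_def frac_rel_def)
  show "trans (frac_rel R)"
  proof (rule transI, clarify)
    fix a s b t c u
    assume 1: "((a, s), (b, t)) \<in> frac_rel R" and 2: "((b, t), (c, u)) \<in> frac_rel R"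
    have cl: "a \<in> carrier R" "b \<in> carrier R" "c \<in> carrier R"
      "s \<in> carrier R" "t \<in> carrier R" "u \<in> carrier R" and tr: "t \<in> reg_elems R"
      and e1: "a \<otimes> t = b \<otimes> s" and e2: "b \<otimes> u = c \<otimes> t"
      using 1 2 by (auto simp: frac_rel_def reg_elems_closed)
    have "t \<otimes> (a \<otimes> u) = (a \<otimes> t) \<otimes> u" using cl by algebra
    also have "\<dots> = (b \<otimes> u) \<otimes> s" unfolding e1 using cl by algebra
    also have "\<dots> = t \<otimes> (c \<otimes> s)" unfolding e2 using cl by algebra
    finally have "a \<otimes> u = c \<otimes> s" using reg_elems_cancel[OF tr] cl by simp
    then show "((a, s), (c, u)) \<in> frac_rel R" using 1 2 by (auto simp: frac_rel_def)
  qed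
qed

lemma frac_eq_iff:
  assumes "a \<in> carrier R" "s \<in> reg_elems R" "b \<in> carrier R" "t \<in> reg_elems R"
  shows "frac_class R a s = frac_class R b t \<longleftrightarrow> a \<otimes> t = b \<otimes> s"
  using eq_equiv_class_iff[OF frac_rel_equiv, of "(a, s)" "(b, t)"] assms
  by (auto simp: frac_class_def frac_rel_def)

lemma frac_self:
  assumes "a \<in> carrier R" "s \<in> reg_elems R" shows "(a, s) \<in> frac_class R a s"
  using assms by (simp add: frac_class_def frac_rel_def)

lemma frac_memD:
  assumes "(b, t) \<in> frac_class R a s"
  shows "a \<in> carrier R" "b \<in> carrier R" "s \<in> reg_elems R" "t \<in> reg_elems R"
    "s \<in> carrier R" "t \<in> carrier R" "a \<otimes> t = b \<otimes> s"
  using assms by (auto simp: frac_class_def frac_rel_def reg_elems_closed)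

lemma frac_closed:
  assumes "a \<in> carrier R" "s \<in> reg_elems R" shows "frac_class R a s \<in> carrier (total_frac R)"
  using assms by (auto simp: total_frac_def frac_class_def intro!: quotientI)

lemma total_frac_cases:
  assumes "X \<in> carrier (total_frac R)"
  obtains a s where "a \<in> carrier R" "s \<in> reg_elems R" "X = frac_class R a s"
  using assms by (auto simp: total_frac_def frac_class_def elim!: quotientE)

lemma total_frac_mult:
  assumes "a \<in> carrier R" "s \<in> reg_elems R" "b \<in> carrier R" "t \<in> reg_elems R"
  shows "frac_class R a s \<otimes>\<^bsub>total_frac R\<^esub> frac_class R b t = frac_class R (a \<otimes> b) (s \<otimes> t)"
proof -
  have eq: "frac_class R (a' \<otimes> b') (s' \<otimes> t') = frac_class R (a \<otimes> b) (s \<otimes> t)"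
    if "(a', s') \<in> frac_class R a s" "(b', t') \<in> frac_class R b t" for a' s' b' t'
  proof -
    note m = frac_memD[OF that(1)] frac_memD[OF that(2)]
    have "(a' \<otimes> b') \<otimes> (s \<otimes> t) = (a' \<otimes> s) \<otimes> (b' \<otimes> t)" using m(1-6,8-13) by algebra
    also have "\<dots> = (a \<otimes> s') \<otimes> (b \<otimes> t')" using m(7,14) by simp
    also have "\<dots> = (a \<otimes> b) \<otimes> (s' \<otimes> t')" using m(1-6,8-13) by algebra
    finally show ?thesis using m by (subst frac_eq_iff) (auto simp: reg_elems_mult)
  qed
  have "frac_class R a s \<otimes>\<^bsub>total_frac R\<^esub> frac_class R b t =
      (\<Union>p\<in>frac_class R a s. \<Union>q\<in>frac_class R b t. frac_class R (fst p \<otimes> fst q) (snd p \<otimes> snd q))"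
    by (simp add: total_frac_def case_prod_beta)
  also have "\<dots> = (\<Union>p\<in>frac_class R a s. \<Union>q\<in>frac_class R b t. frac_class R (a \<otimes> b) (s \<otimes> t))"
    by (intro SUP_cong refl eq) auto
  also have "\<dots> = frac_class R (a \<otimes> b) (s \<otimes> t)"
    using frac_self[OF assms(1,2)] frac_self[OF assms(3,4)] by auto
  finally show ?thesis .
qed

lemma total_frac_add:
  assumes "a \<in> carrier R" "s \<in> reg_elems R" "b \<in> carrier R" "t \<in> reg_elems R"
  shows "frac_class R a s \<oplus>\<^bsub>total_frac R\<^esub> frac_class R b t = frac_class R (a \<otimes> t \<oplus> b \<otimes> s) (s \<otimes> t)"
proof -
  have eq: "frac_class R (a' \<otimes> t' \<oplus> b' \<otimes> s') (s' \<otimes> t') = frac_class R (a \<otimes> t \<oplus> b \<otimes> s) (s \<otimes> t)"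
    if "(a', s') \<in> frac_class R a s" "(b', t') \<in> frac_class R b t" for a' s' b' t'
  proof -
    note m = frac_memD[OF that(1)] frac_memD[OF that(2)]
    have "(a' \<otimes> t' \<oplus> b' \<otimes> s') \<otimes> (s \<otimes> t) =
        (a' \<otimes> s) \<otimes> (t \<otimes> t') \<oplus> (b' \<otimes> t) \<otimes> (s \<otimes> s')" using m(1-6,8-13) by algebra
    also have "\<dots> = (a \<otimes> s') \<otimes> (t \<otimes> t') \<oplus> (b \<otimes> t') \<otimes> (s \<otimes> s')"
      using m(7,14) by simp
    also have "\<dots> = (a \<otimes> t \<oplus> b \<otimes> s) \<otimes> (s' \<otimes> t')" using m(1-6,8-13) by algebra
    finally show ?thesis using m by (subst frac_eq_iff) (auto simp: reg_elems_mult)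
  qed
  have "frac_class R a s \<oplus>\<^bsub>total_frac R\<^esub> frac_class R b t = (\<Union>p\<in>frac_class R a s. \<Union>q\<in>frac_class R b t.
      frac_class R (fst p \<otimes> snd q \<oplus> fst q \<otimes> snd p) (snd p \<otimes> snd q))"
    by (simp add: total_frac_def case_prod_beta)
  also have "\<dots> = (\<Union>p\<in>frac_class R a s. \<Union>q\<in>frac_class R b t. frac_class R (a \<otimes> t \<oplus> b \<otimes> s) (s \<otimes> t))"
    by (intro SUP_cong refl eq) auto
  also have "\<dots> = frac_class R (a \<otimes> t \<oplus> b \<otimes> s) (s \<otimes> t)"
    using frac_self[OF assms(1,2)] frac_self[OF assms(3,4)] by auto
  finally show ?thesis .
qed

lemma total_frac_smult:
  assumes "c \<in> carrier R" "a \<in> carrier R" "s \<in> reg_elems R"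
  shows "c \<odot>\<^bsub>total_frac R\<^esub> frac_class R a s = frac_class R (c \<otimes> a) s"
proof -
  have eq: "frac_class R (c \<otimes> a') s' = frac_class R (c \<otimes> a) s" if "(a', s') \<in> frac_class R a s" for a' s'
  proof -
    note m = frac_memD[OF that]
    have "(c \<otimes> a') \<otimes> s = (c \<otimes> a) \<otimes> s'" using m assms(1) by (simp add: m_assoc)
    then show ?thesis using m assms(1) by (subst frac_eq_iff) auto
  qed
  have "c \<odot>\<^bsub>total_frac R\<^esub> frac_class R a s = (\<Union>p\<in>frac_class R a s. frac_class R (c \<otimes> fst p) (snd p))"
    by (simp add: total_frac_def case_prod_beta)
  also have "\<dots> = (\<Union>p\<in>frac_class R a s. frac_class R (c \<otimes> a) s)"
    by (intro SUP_cong refl eq) auto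
  also have "\<dots> = frac_class R (c \<otimes> a) s"
    using frac_self[OF assms(2,3)] by auto
  finally show ?thesis .
qed

lemma total_frac_one: "\<one>\<^bsub>total_frac R\<^esub> = frac_class R \<one> \<one>"
  and total_frac_zero: "\<zero>\<^bsub>total_frac R\<^esub> = frac_class R \<zero> \<one>"
  by (simp_all add: total_frac_def)

lemmas total_frac_simps = total_frac_mult total_frac_add total_frac_smult
  total_frac_one total_frac_zero reg_elems_one reg_elems_mult reg_elems_closed frac_closed

lemma total_frac_cring: "cring (total_frac R)"
proof (rule cringI)
  show "abelian_group (total_frac R)"
  proof (rule abelian_groupI)
    fix X Y Z
    assume "X \<in> carrier (total_frac R)" "Y \<in> carrier (total_frac R)" "Z \<in> carrier (total_frac R)"
    then obtain a s b t c u where m: "a \<in> carrier R" "s \<in> reg_elems R" "b \<in> carrier R"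
      "t \<in> reg_elems R" "c \<in> carrier R" "u \<in> reg_elems R"
      and X: "X = frac_class R a s" and Y: "Y = frac_class R b t" and Z: "Z = frac_class R c u"
      by (elim total_frac_cases) blast
    have m': "s \<in> carrier R" "t \<in> carrier R" "u \<in> carrier R"
      using m by (simp_all add: reg_elems_closed)
    have "(a \<otimes> t \<oplus> b \<otimes> s) \<otimes> u \<oplus> c \<otimes> (s \<otimes> t) = a \<otimes> (t \<otimes> u) \<oplus> (b \<otimes> u \<oplus> c \<otimes> t) \<otimes> s"
      using m m' by algebra
    then show "X \<oplus>\<^bsub>total_frac R\<^esub> Y \<oplus>\<^bsub>total_frac R\<^esub> Z = X \<oplus>\<^bsub>total_frac R\<^esub> (Y \<oplus>\<^bsub>total_frac R\<^esub> Z)"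
      using m m' unfolding X Y Z by (simp add: total_frac_simps m_assoc)
  next
    fix X Y
    assume "X \<in> carrier (total_frac R)" "Y \<in> carrier (total_frac R)"
    then obtain a s b t where m: "a \<in> carrier R" "s \<in> reg_elems R" "b \<in> carrier R"
      "t \<in> reg_elems R" and X: "X = frac_class R a s" and Y: "Y = frac_class R b t"
      by (elim total_frac_cases) blast
    show "X \<oplus>\<^bsub>total_frac R\<^esub> Y = Y \<oplus>\<^bsub>total_frac R\<^esub> X"
      using m unfolding X Y by (simp add: total_frac_simps m_comm a_comm)
    show "X \<oplus>\<^bsub>total_frac R\<^esub> Y \<in> carrier (total_frac R)"
      using m unfolding X Y by (simp add: total_frac_simps)
  next
    fix X assume "X \<in> carrier (total_frac R)"
    then obtain a s where m: "a \<in> carrier R" "s \<in> reg_elems R" and X: "X = frac_class R a s"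
      by (elim total_frac_cases) blast
    show "\<zero>\<^bsub>total_frac R\<^esub> \<oplus>\<^bsub>total_frac R\<^esub> X = X"
      using m unfolding X by (simp add: total_frac_simps)
    have "(\<ominus> a \<otimes> s \<oplus> a \<otimes> s) = \<zero>"
      using m by (simp add: reg_elems_closed l_minus l_neg)
    then have "frac_class R (\<ominus> a) s \<oplus>\<^bsub>total_frac R\<^esub> X = \<zero>\<^bsub>total_frac R\<^esub>"
      using m unfolding X by (simp add: total_frac_simps frac_eq_iff)
    then show "\<exists>Y\<in>carrier (total_frac R). Y \<oplus>\<^bsub>total_frac R\<^esub> X = \<zero>\<^bsub>total_frac R\<^esub>"
      using m by (blast intro: frac_closed a_inv_closed)
  qed (simp add: total_frac_simps)
  show "comm_monoid (total_frac R)"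
  proof (rule comm_monoidI)
    fix X Y Z
    assume "X \<in> carrier (total_frac R)" "Y \<in> carrier (total_frac R)" "Z \<in> carrier (total_frac R)"
    then show "X \<otimes>\<^bsub>total_frac R\<^esub> Y \<otimes>\<^bsub>total_frac R\<^esub> Z = X \<otimes>\<^bsub>total_frac R\<^esub> (Y \<otimes>\<^bsub>total_frac R\<^esub> Z)"
      by (elim total_frac_cases) (simp add: total_frac_simps m_assoc)
  next
    fix X Y
    assume "X \<in> carrier (total_frac R)" "Y \<in> carrier (total_frac R)"
    then show "X \<otimes>\<^bsub>total_frac R\<^esub> Y = Y \<otimes>\<^bsub>total_frac R\<^esub> X"
      and "X \<otimes>\<^bsub>total_frac R\<^esub> Y \<in> carrier (total_frac R)"
      by (elim total_frac_cases; simp add: total_frac_simps m_comm)+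
  next
    fix X assume "X \<in> carrier (total_frac R)"
    then show "\<one>\<^bsub>total_frac R\<^esub> \<otimes>\<^bsub>total_frac R\<^esub> X = X"
      by (elim total_frac_cases) (simp add: total_frac_simps)
  qed (simp add: total_frac_simps)
  fix X Y Z
  assume "X \<in> carrier (total_frac R)" "Y \<in> carrier (total_frac R)" "Z \<in> carrier (total_frac R)"
  then obtain a s b t c u where m: "a \<in> carrier R" "s \<in> reg_elems R" "b \<in> carrier R"
    "t \<in> reg_elems R" "c \<in> carrier R" "u \<in> reg_elems R"
    and X: "X = frac_class R a s" and Y: "Y = frac_class R b t" and Z: "Z = frac_class R c u"
    by (elim total_frac_cases) blast
  have m': "s \<in> carrier R" "t \<in> carrier R" "u \<in> carrier R"
    using m by (simp_all add: reg_elems_closed)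
  have "((a \<otimes> t \<oplus> b \<otimes> s) \<otimes> c) \<otimes> ((s \<otimes> u) \<otimes> (t \<otimes> u)) =
      ((a \<otimes> c) \<otimes> (t \<otimes> u) \<oplus> (b \<otimes> c) \<otimes> (s \<otimes> u)) \<otimes> ((s \<otimes> t) \<otimes> u)"
    using m m' by algebra
  then show "(X \<oplus>\<^bsub>total_frac R\<^esub> Y) \<otimes>\<^bsub>total_frac R\<^esub> Z =
      X \<otimes>\<^bsub>total_frac R\<^esub> Z \<oplus>\<^bsub>total_frac R\<^esub> Y \<otimes>\<^bsub>total_frac R\<^esub> Z"
    using m m' unfolding X Y Z by (simp add: total_frac_simps frac_eq_iff)
qed

lemma total_frac_algebra: "algebra R (total_frac R)"
proof (rule algebraI)
  interpret Q: cring "total_frac R" by (rule total_frac_cring)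
  have sm: "c \<odot>\<^bsub>total_frac R\<^esub> X = frac_embed R c \<otimes>\<^bsub>total_frac R\<^esub> X"
    if "c \<in> carrier R" "X \<in> carrier (total_frac R)" for c X
    using that(2) by (elim total_frac_cases) (simp add: that total_frac_simps frac_embed_def)
  have em: "frac_embed R c \<in> carrier (total_frac R)" if "c \<in> carrier R" for c
    using that by (simp add: frac_embed_def total_frac_simps)
  have emadd: "frac_embed R (c \<oplus> d) = frac_embed R c \<oplus>\<^bsub>total_frac R\<^esub> frac_embed R d"
    and emmult: "frac_embed R (c \<otimes> d) = frac_embed R c \<otimes>\<^bsub>total_frac R\<^esub> frac_embed R d"
    if "c \<in> carrier R" "d \<in> carrier R" for c d
    using that by (simp_all add: frac_embed_def total_frac_simps)
  have emone: "frac_embed R \<one> = \<one>\<^bsub>total_frac R\<^esub>"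
    by (simp add: frac_embed_def total_frac_simps)
  show "cring R" by (rule is_cring)
  show "cring (total_frac R)" by (rule total_frac_cring)
  show "\<one> \<odot>\<^bsub>total_frac R\<^esub> X = X" if "X \<in> carrier (total_frac R)" for X
    using that by (simp add: sm emone)
  fix c X assume cX: "c \<in> carrier R" "X \<in> carrier (total_frac R)"
  then show "c \<odot>\<^bsub>total_frac R\<^esub> X \<in> carrier (total_frac R)" by (simp add: sm em)
  {
    fix d assume "d \<in> carrier R"
    then show "(c \<oplus> d) \<odot>\<^bsub>total_frac R\<^esub> X =
        c \<odot>\<^bsub>total_frac R\<^esub> X \<oplus>\<^bsub>total_frac R\<^esub> d \<odot>\<^bsub>total_frac R\<^esub> X"
      and "(c \<otimes> d) \<odot>\<^bsub>total_frac R\<^esub> X = c \<odot>\<^bsub>total_frac R\<^esub> (d \<odot>\<^bsub>total_frac R\<^esub> X)"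
      using cX by (simp_all add: sm em emadd emmult Q.l_distr Q.m_assoc)
  }
  fix Y assume "Y \<in> carrier (total_frac R)"
  then show "c \<odot>\<^bsub>total_frac R\<^esub> (X \<oplus>\<^bsub>total_frac R\<^esub> Y) =
      c \<odot>\<^bsub>total_frac R\<^esub> X \<oplus>\<^bsub>total_frac R\<^esub> c \<odot>\<^bsub>total_frac R\<^esub> Y"
    and "(c \<odot>\<^bsub>total_frac R\<^esub> X) \<otimes>\<^bsub>total_frac R\<^esub> Y =
      c \<odot>\<^bsub>total_frac R\<^esub> (X \<otimes>\<^bsub>total_frac R\<^esub> Y)"
    using cX by (simp_all add: sm em Q.r_distr Q.m_assoc)
qed

lemma frac_embed_hom: "frac_embed R \<in> ring_hom R (total_frac R)"
  by (rule ring_hom_memI) (simp_all add: frac_embed_def total_frac_simps)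

lemma frac_embed_inj: "inj_on (frac_embed R) (carrier R)"
  by (rule inj_onI) (simp add: frac_embed_def frac_eq_iff reg_elems_one)

lemma frac_embed_unit:
  assumes "s \<in> reg_elems R" shows "frac_embed R s \<in> Units (total_frac R)"
proof -
  have "frac_class R \<one> s \<otimes>\<^bsub>total_frac R\<^esub> frac_embed R s = \<one>\<^bsub>total_frac R\<^esub>"
    "frac_embed R s \<otimes>\<^bsub>total_frac R\<^esub> frac_class R \<one> s = \<one>\<^bsub>total_frac R\<^esub>"
    using assms by (simp_all add: frac_embed_def total_frac_simps frac_eq_iff)
  moreover have "frac_class R \<one> s \<in> carrier (total_frac R)" "frac_embed R s \<in> carrier (total_frac R)"
    using assms by (simp_all add: frac_embed_def total_frac_simps)
  ultimately show ?thesis by (auto simp: Units_def)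
qed

end

end

theory Submission
  imports Defs "HOL-Algebra.QuotRing"
begin

text \<open>Invertibility of an ideal \<open>I\<close> containing a regular element \<open>a\<close> can be tested inside the ring:
  it holds exactly when \<open>a \<in> I (aR : I)\<close>, where \<open>aR : I\<close> is the ideal of those \<open>c\<close> with
  \<open>I c \<subseteq> aR\<close> (lemmas \<open>invertible_ideal_imp_colon\<close> and \<open>colon_imp_invertible_ideal\<close>). Indeed the \<open>R\<close>-submodule of the total ring of
  fractions that is inverse to \<open>I\<close> must be \<open>(aR : I) / a\<close>, and \<open>1 \<in> I (aR : I) / a\<close> is the stated
  condition after multiplication by \<open>a\<close>.

  Unlike the original definition, this criterion mentions no fractions, and so it passes along a
  surjective morphism \<open>f : A \<rightarrow> B\<close> although \<open>f\<close> need not extend to the total rings of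
  fractions: if \<open>I c \<subseteq> aA\<close>, then \<open>f(I) f(c) \<subseteq> f(a)B\<close>. Given a finitely generated ideal of \<open>B\<close> containing
  a regular element \<open>b\<close>, lift its generators to \<open>A\<close>. They generate an ideal \<open>I\<close> with \<open>f(I)\<close> the
  given one, so \<open>b = f(a)\<close> for some \<open>a \<in> I\<close>, and \<open>a\<close> is regular because \<open>f\<close> is a regular
  morphism. As \<open>A\<close> is a Pruefer ring, \<open>I\<close> is invertible; hence \<open>a \<in> I (aA : I)\<close>, and applying
  \<open>f\<close> gives \<open>b \<in> f(I) (bB : f(I))\<close>.\<close>


section \<open>Colon ideals\<close>

definition colon_ideal :: "('a, 'm) ring_scheme \<Rightarrow> 'a set \<Rightarrow> 'a set \<Rightarrow> 'a set" where
  "colon_ideal R J I = {c \<in> carrier R. \<forall>x\<in>I. x \<otimes>\<^bsub>R\<^esub> c \<in> J}"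

lemma colon_idealD: "c \<in> colon_ideal R J I \<Longrightarrow> x \<in> I \<Longrightarrow> x \<otimes>\<^bsub>R\<^esub> c \<in> J"
  by (simp add: colon_ideal_def)

lemma (in cring) colon_ideal_is_ideal:
  assumes J: "ideal J R" and I: "I \<subseteq> carrier R"
  shows "ideal (colon_ideal R J I) R"
proof -
  interpret J: ideal J R by (rule J)
  have neg: "\<ominus> c \<in> colon_ideal R J I" if "c \<in> colon_ideal R J I" for c
    using that I by (auto simp: colon_ideal_def r_minus subset_iff)
  have scale: "r \<otimes> c \<in> colon_ideal R J I" if "c \<in> colon_ideal R J I" "r \<in> carrier R" for r c
  proof -
    have "x \<otimes> (r \<otimes> c) \<in> J" if x: "x \<in> I" for x
    proof -
      have "x \<otimes> (r \<otimes> c) = r \<otimes> (x \<otimes> c)"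
        using \<open>c \<in> colon_ideal R J I\<close> \<open>r \<in> carrier R\<close> x I
        by (intro m_lcomm) (auto simp: colon_ideal_def)
      then show ?thesis
        using \<open>c \<in> colon_ideal R J I\<close> \<open>r \<in> carrier R\<close> x
        by (simp add: colon_ideal_def J.I_l_closed)
    qed
    then show ?thesis using that by (simp add: colon_ideal_def)
  qed
  show ?thesis
  proof (rule idealI[OF ring_axioms])
    show "subgroup (colon_ideal R J I) (add_monoid R)"
    proof (rule add.subgroupI)
      show "colon_ideal R J I \<noteq> {}"
        using I by (auto simp: colon_ideal_def subset_iff intro!: exI[of _ \<zero>])
    next
      fix c d assume "c \<in> colon_ideal R J I" "d \<in> colon_ideal R J I"
      then show "c \<oplus> d \<in> colon_ideal R J I"
        using I by (auto simp: colon_ideal_def subset_iff r_distr)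
    qed (use neg in \<open>auto simp: colon_ideal_def a_inv_def\<close>)
  next
    fix c r assume c: "c \<in> colon_ideal R J I" and r: "r \<in> carrier R"
    then show "r \<otimes> c \<in> colon_ideal R J I" by (rule scale)
    moreover have "c \<in> carrier R" using c by (simp add: colon_ideal_def)
    ultimately show "c \<otimes> r \<in> colon_ideal R J I" using r by (simp add: m_comm)
  qed
qed


section \<open>Invertibility without fractions\<close>

text \<open>Every element \<open>y\<close> of an inverse of \<open>I\<close> satisfies \<open>I y \<subseteq> R\<close>. In particular \<open>a y\<close> lies in \<open>R\<close>,
  and even in \<open>aR : I\<close>. Multiplying an expression of \<open>1\<close> as a sum of products \<open>x y\<close> by \<open>a\<close>
  therefore expresses \<open>a\<close> as a sum of products \<open>x (a y)\<close> of elements of \<open>I\<close> and of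
  \<open>aR : I\<close>.\<close>

lemma (in cring) invertible_ideal_imp_colon:
  assumes inv: "invertible_ideal I R" and aI: "a \<in> I"
  shows "a \<in> I \<cdot> colon_ideal R (PIdl a) I"
proof -
  let ?Q = "total_frac R" and ?e = "frac_embed R" and ?K = "colon_ideal R (PIdl a) I"
  interpret Q: cring ?Q by (rule total_frac_cring)
  interpret e: ring_hom_cring R ?Q ?e
    by unfold_locales (rule frac_embed_hom)
  obtain J where I: "ideal I R" and J: "submodule J R ?Q"
    and IJ: "(?e ` I) \<cdot>\<^bsub>?Q\<^esub> J = ?e ` carrier R"
    using inv by (auto simp: invertible_ideal_def)
  interpret I: ideal I R by (rule I)
  have Jc: "y \<in> carrier ?Q" if "y \<in> J" for y
    using subgroup.subset[OF submodule.axioms(1)[OF J]] that by auto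
  have a: "a \<in> carrier R" using aI by (rule I.Icarr)
  have K: "ideal ?K R" by (intro colon_ideal_is_ideal cgenideal_ideal a I.a_subset)
  have IK: "I \<cdot> ?K \<subseteq> carrier R" by (rule ideal_prod_in_carrier[OF I K])
  have IJc: "X \<in> carrier ?Q" if "X \<in> (?e ` I) \<cdot>\<^bsub>?Q\<^esub> J" for X
    using that unfolding IJ by auto
  have integral: "\<exists>r\<in>carrier R. ?e x \<otimes>\<^bsub>?Q\<^esub> y = ?e r" if "x \<in> I" "y \<in> J" for x y
    using ideal_prod.prod[of "?e x" "?e ` I" y J ?Q] that unfolding IJ by auto
  have numerator: "\<exists>c\<in>?K. ?e a \<otimes>\<^bsub>?Q\<^esub> y = ?e c" if y: "y \<in> J" for y
  proof -
    obtain c where c: "c \<in> carrier R" and ec: "?e a \<otimes>\<^bsub>?Q\<^esub> y = ?e c"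
      using integral[OF aI y] by blast
    have "x \<otimes> c \<in> PIdl a" if x: "x \<in> I" for x
    proof -
      have xc: "x \<in> carrier R" using x by (rule I.Icarr)
      obtain r where r: "r \<in> carrier R" and er: "?e x \<otimes>\<^bsub>?Q\<^esub> y = ?e r"
        using integral[OF x y] by blast
      have "?e (x \<otimes> c) = ?e x \<otimes>\<^bsub>?Q\<^esub> (?e a \<otimes>\<^bsub>?Q\<^esub> y)"
        using xc c by (simp add: ec)
      also have "\<dots> = ?e a \<otimes>\<^bsub>?Q\<^esub> (?e x \<otimes>\<^bsub>?Q\<^esub> y)"
        using xc a Jc[OF y] by (simp add: Q.m_lcomm)
      also have "\<dots> = ?e (r \<otimes> a)"
        using r a by (simp add: er Q.m_comm)
      finally have "x \<otimes> c = r \<otimes> a"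
        using xc c r a by (intro inj_onD[OF frac_embed_inj]) auto
      then show ?thesis using r by (auto simp: cgenideal_def)
    qed
    then show ?thesis using c ec by (auto simp: colon_ideal_def)
  qed
  have clear: "\<exists>z\<in>I \<cdot> ?K. ?e a \<otimes>\<^bsub>?Q\<^esub> X = ?e z" if "X \<in> (?e ` I) \<cdot>\<^bsub>?Q\<^esub> J" for X
    using that
  proof (induction rule: ideal_prod.induct)
    case (prod i y)
    then obtain x where x: "x \<in> I" and i: "i = ?e x" by blast
    obtain c where c: "c \<in> ?K" and ec: "?e a \<otimes>\<^bsub>?Q\<^esub> y = ?e c"
      using numerator[OF prod(2)] by blast
    have xc: "x \<in> carrier R" "c \<in> carrier R"
      using x c by (auto simp: colon_ideal_def I.Icarr)
    have "?e a \<otimes>\<^bsub>?Q\<^esub> (i \<otimes>\<^bsub>?Q\<^esub> y) = ?e x \<otimes>\<^bsub>?Q\<^esub> (?e a \<otimes>\<^bsub>?Q\<^esub> y)"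
      using xc a Jc[OF prod(2)] by (simp add: i Q.m_lcomm)
    also have "\<dots> = ?e (x \<otimes> c)" using xc by (simp add: ec)
    finally show ?case using ideal_prod.prod[of x I c ?K R] x c by blast
  next
    case (sum X Y)
    then obtain z w where z: "z \<in> I \<cdot> ?K" "?e a \<otimes>\<^bsub>?Q\<^esub> X = ?e z"
      and w: "w \<in> I \<cdot> ?K" "?e a \<otimes>\<^bsub>?Q\<^esub> Y = ?e w" by blast
    have "?e a \<otimes>\<^bsub>?Q\<^esub> (X \<oplus>\<^bsub>?Q\<^esub> Y) = ?e (z \<oplus> w)"
      using IK z w a IJc[OF sum(1)] IJc[OF sum(2)] by (auto simp: Q.r_distr subset_iff)
    then show ?case using ideal_prod.sum[OF z(1) w(1)] by blast
  qed
  have "\<one>\<^bsub>?Q\<^esub> \<in> (?e ` I) \<cdot>\<^bsub>?Q\<^esub> J"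
    unfolding IJ using e.hom_one by (metis imageI one_closed)
  then obtain z where z: "z \<in> I \<cdot> ?K" and "?e a = ?e z"
    using clear[of "\<one>\<^bsub>?Q\<^esub>"] a by auto
  then have "a = z" using IK a by (intro inj_onD[OF frac_embed_inj]) auto
  then show ?thesis using z by simp
qed

text \<open>Conversely, \<open>(aR : I) / a\<close> is an inverse of \<open>I\<close>: its product with \<open>I\<close> lies in \<open>R\<close> by the choice
  of the colon ideal, and it contains \<open>1 = a / a\<close> by hypothesis.\<close>

lemma (in cring) colon_imp_invertible_ideal:
  assumes I: "ideal I R" and reg: "a \<in> reg_elems R"
    and mem: "a \<in> I \<cdot> colon_ideal R (PIdl a) I"
  shows "invertible_ideal I R"
proof -
  let ?Q = "total_frac R" and ?e = "frac_embed R" and ?K = "colon_ideal R (PIdl a) I"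
  let ?J = "(\<lambda>c. frac_class R c a) ` ?K"
  interpret Q: cring ?Q by (rule total_frac_cring)
  interpret alg: algebra R ?Q by (rule total_frac_algebra)
  interpret e: ring_hom_cring R ?Q ?e
    by unfold_locales (rule frac_embed_hom)
  interpret I: ideal I R by (rule I)
  have a: "a \<in> carrier R" using reg by (rule reg_elems_closed)
  have K: "ideal ?K R" by (intro colon_ideal_is_ideal cgenideal_ideal a I.a_subset)
  interpret K: ideal ?K R by (rule K)
  have IKi: "ideal (I \<cdot> ?K) R" by (rule ideal_prod_is_ideal[OF I K])
  have IK: "I \<cdot> ?K \<subseteq> carrier R" by (rule ideal_prod_in_carrier[OF I K])
  have frac_sum: "frac_class R c a \<oplus>\<^bsub>?Q\<^esub> frac_class R d a = frac_class R (c \<oplus> d) a"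
    if "c \<in> carrier R" "d \<in> carrier R" for c d
  proof -
    have "(c \<otimes> a \<oplus> d \<otimes> a) \<otimes> a = (c \<oplus> d) \<otimes> (a \<otimes> a)" using that a by algebra
    then show ?thesis using that reg a
      by (simp add: total_frac_add frac_eq_iff reg_elems_mult)
  qed
  have frac_prod: "?e x \<otimes>\<^bsub>?Q\<^esub> frac_class R c a = frac_class R (x \<otimes> c) a"
    if "x \<in> carrier R" "c \<in> carrier R" for x c
    using that reg a by (simp add: frac_embed_def total_frac_mult reg_elems_one)
  have frac_cancel: "frac_class R (r \<otimes> a) a = ?e r" if "r \<in> carrier R" for r
    using that reg a by (simp add: frac_embed_def frac_eq_iff reg_elems_one)
  have J: "submodule ?J R ?Q"
  proof (rule alg.submoduleI)
    show "?J \<subseteq> carrier ?Q" using reg by (auto intro!: frac_closed K.Icarr)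
    have zero: "\<zero>\<^bsub>?Q\<^esub> = frac_class R \<zero> a"
      using a reg by (simp add: total_frac_zero frac_eq_iff reg_elems_one)
    then show "\<zero>\<^bsub>?Q\<^esub> \<in> ?J" by (simp add: K.zero_closed)
    fix X assume "X \<in> ?J"
    then obtain c where c: "c \<in> ?K" and X: "X = frac_class R c a" by blast
    have cc: "c \<in> carrier R" using c by (rule K.Icarr)
    have "frac_class R (\<ominus> c) a \<oplus>\<^bsub>?Q\<^esub> X = \<zero>\<^bsub>?Q\<^esub>"
      using cc by (simp add: X zero frac_sum l_neg)
    then have "\<ominus>\<^bsub>?Q\<^esub> X = frac_class R (\<ominus> c) a"
      using cc reg by (intro Q.minus_equality) (auto simp: X intro: frac_closed)
    then show "\<ominus>\<^bsub>?Q\<^esub> X \<in> ?J" using c by simp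
    {
      fix Y assume "Y \<in> ?J"
      then obtain d where d: "d \<in> ?K" and Y: "Y = frac_class R d a" by blast
      then show "X \<oplus>\<^bsub>?Q\<^esub> Y \<in> ?J"
        using c cc K.Icarr[OF d] by (simp add: X frac_sum)
    }
    fix r assume "r \<in> carrier R"
    then show "r \<odot>\<^bsub>?Q\<^esub> X \<in> ?J"
      using c cc reg by (simp add: X total_frac_smult K.I_l_closed)
  qed
  have "(?e ` I) \<cdot>\<^bsub>?Q\<^esub> ?J \<subseteq> ?e ` carrier R"
  proof
    fix X assume "X \<in> (?e ` I) \<cdot>\<^bsub>?Q\<^esub> ?J"
    then show "X \<in> ?e ` carrier R"
    proof (induction rule: ideal_prod.induct)
      case (prod i y)
      then obtain x c where x: "x \<in> I" "i = ?e x" and c: "c \<in> ?K" "y = frac_class R c a"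
        by blast
      have "x \<otimes> c \<in> PIdl a" using c(1) x(1) by (rule colon_idealD)
      then obtain r where r: "r \<in> carrier R" "x \<otimes> c = r \<otimes> a"
        unfolding cgenideal_def by blast
      have "i \<otimes>\<^bsub>?Q\<^esub> y = frac_class R (x \<otimes> c) a"
        unfolding x(2) c(2) by (intro frac_prod I.Icarr[OF x(1)] K.Icarr[OF c(1)])
      also have "\<dots> = ?e r" unfolding r(2) by (rule frac_cancel[OF r(1)])
      finally have "i \<otimes>\<^bsub>?Q\<^esub> y = ?e r" .
      then show ?case using r by blast
    next
      case (sum X Y)
      then obtain r s where "r \<in> carrier R" "s \<in> carrier R" "X = ?e r" "Y = ?e s" by blast
      then have "X \<oplus>\<^bsub>?Q\<^esub> Y = ?e (r \<oplus> s)" "r \<oplus> s \<in> carrier R" by simp_all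
      then show ?case by blast
    qed
  qed
  moreover have frac_mem: "frac_class R w a \<in> (?e ` I) \<cdot>\<^bsub>?Q\<^esub> ?J" if "w \<in> I \<cdot> ?K" for w
    using that
  proof (induction rule: ideal_prod.induct)
    case (prod x c)
    then show ?case
      using ideal_prod.prod[of "?e x" "?e ` I" "frac_class R c a" ?J ?Q]
      by (simp add: frac_prod I.Icarr K.Icarr)
  next
    case (sum w v)
    then show ?case
      using ideal_prod.sum[OF sum(3,4)] IK by (auto simp: frac_sum subset_iff)
  qed
  moreover have "?e r \<in> (?e ` I) \<cdot>\<^bsub>?Q\<^esub> ?J" if r: "r \<in> carrier R" for r
    using frac_mem[OF ideal.I_l_closed[OF IKi mem r]] frac_cancel[OF r] by simp
  ultimately have "(?e ` I) \<cdot>\<^bsub>?Q\<^esub> ?J = ?e ` carrier R" by blast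
  then show ?thesis using I J by (auto simp: invertible_ideal_def)
qed


section \<open>Ideals under ring homomorphisms\<close>

lemma (in ring_hom_ring) surj_image_ideal:
  assumes surj: "h ` carrier R = carrier S" and I: "ideal I R"
  shows "ideal (h ` I) S"
proof -
  interpret I: ideal I R by (rule I)
  show ?thesis
  proof (rule idealI[OF S.ring_axioms])
    show "subgroup (h ` I) (add_monoid S)"
      using a_group_hom group_hom.subgroup_img_is_subgroup I.a_subgroup by blast
    fix y s assume "y \<in> h ` I" "s \<in> carrier S"
    then obtain x r where x: "x \<in> I" "y = h x" and r: "r \<in> carrier R" "s = h r"
      using surj by blast
    have "s \<otimes>\<^bsub>S\<^esub> y = h (r \<otimes> x)" "y \<otimes>\<^bsub>S\<^esub> s = h (x \<otimes> r)"
      using x r by (simp_all add: I.Icarr)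
    then show "s \<otimes>\<^bsub>S\<^esub> y \<in> h ` I" "y \<otimes>\<^bsub>S\<^esub> s \<in> h ` I"
      using x r I.I_l_closed I.I_r_closed by blast+
  qed
qed

lemma (in ring_hom_ring) surj_image_genideal:
  assumes surj: "h ` carrier R = carrier S" and T: "T \<subseteq> carrier R"
  shows "h ` (Idl T) = Idl\<^bsub>S\<^esub> (h ` T)"
proof
  have TS: "h ` T \<subseteq> carrier S" using T by auto
  have "ideal {r \<in> carrier R. h r \<in> Idl\<^bsub>S\<^esub> (h ` T)} R"
    by (rule ideal_vimage[OF S.genideal_ideal[OF TS]])
  then have "Idl T \<subseteq> {r \<in> carrier R. h r \<in> Idl\<^bsub>S\<^esub> (h ` T)}"
    using T S.genideal_self[OF TS] by (intro R.genideal_minimal) auto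
  then show "h ` (Idl T) \<subseteq> Idl\<^bsub>S\<^esub> (h ` T)" by blast
  show "Idl\<^bsub>S\<^esub> (h ` T) \<subseteq> h ` (Idl T)"
    using R.genideal_self[OF T]
    by (intro S.genideal_minimal surj_image_ideal surj R.genideal_ideal T) auto
qed

lemma (in ring_hom_ring) ideal_prod_image:
  assumes I: "I \<subseteq> carrier R" and K: "K \<subseteq> carrier R" and z: "z \<in> I \<cdot> K"
  shows "h z \<in> (h ` I) \<cdot>\<^bsub>S\<^esub> (h ` K)"
proof -
  from z have "z \<in> carrier R \<and> h z \<in> (h ` I) \<cdot>\<^bsub>S\<^esub> (h ` K)"
  proof (induction rule: ideal_prod.induct)
    case (prod i k)
    then have "i \<in> carrier R" "k \<in> carrier R" using I K by auto
    then show ?case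
      using ideal_prod.prod[of "h i" "h ` I" "h k" "h ` K" S] prod by simp
  next
    case (sum u v)
    then show ?case using ideal_prod.sum[of "h u" S _ _ "h v"] by simp
  qed
  then show ?thesis by simp
qed

lemma ideal_prod_mono:
  assumes "K \<subseteq> L" shows "I \<cdot>\<^bsub>R\<^esub> K \<subseteq> I \<cdot>\<^bsub>R\<^esub> L"
proof
  fix z assume "z \<in> I \<cdot>\<^bsub>R\<^esub> K"
  then show "z \<in> I \<cdot>\<^bsub>R\<^esub> L"
    by induction (use assms in \<open>auto intro: ideal_prod.intros\<close>)
qed

lemma (in ring_hom_ring) colon_ideal_image:
  assumes "I \<subseteq> carrier R"
  shows "h ` colon_ideal R J I \<subseteq> colon_ideal S (h ` J) (h ` I)"
proof
  fix y assume "y \<in> h ` colon_ideal R J I"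
  then obtain c where c: "c \<in> carrier R" "y = h c" and Jc: "\<And>x. x \<in> I \<Longrightarrow> x \<otimes> c \<in> J"
    by (auto simp: colon_ideal_def)
  have "h x \<otimes>\<^bsub>S\<^esub> y \<in> h ` J" if x: "x \<in> I" for x
  proof -
    have "h x \<otimes>\<^bsub>S\<^esub> y = h (x \<otimes> c)" using assms x c by auto
    then show ?thesis using Jc[OF x] by blast
  qed
  then show "y \<in> colon_ideal S (h ` J) (h ` I)" using c by (auto simp: colon_ideal_def)
qed

lemma (in ring_hom_ring) surj_image_cgenideal:
  assumes "h ` carrier R = carrier S" "a \<in> carrier R"
  shows "h ` (PIdl a) = PIdl\<^bsub>S\<^esub> (h a)"
proof -
  have "h ` (PIdl a) = (\<lambda>r. h r \<otimes>\<^bsub>S\<^esub> h a) ` carrier R"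
    using assms(2) by (force simp: cgenideal_def image_iff)
  also have "\<dots> = (\<lambda>s. s \<otimes>\<^bsub>S\<^esub> h a) ` (h ` carrier R)" by (simp add: image_image)
  also have "\<dots> = PIdl\<^bsub>S\<^esub> (h a)" unfolding assms(1) by (auto simp: cgenideal_def)
  finally show ?thesis .
qed

text \<open>The image of an inverse fractional ideal under \<open>h\<close> need not make sense, as \<open>h\<close> may send
  regular denominators to zero divisors. The criterion by colon ideals uses only the denominator
  \<open>a\<close>, whose image is regular by assumption.\<close>

lemma (in ring_hom_cring) surj_image_invertible_ideal:
  assumes surj: "h ` carrier R = carrier S" and inv: "invertible_ideal I R"
    and a: "a \<in> I" and reg: "h a \<in> reg_elems S"
  shows "invertible_ideal (h ` I) S"
proof (rule S.colon_imp_invertible_ideal[OF _ reg])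
  have I: "ideal I R" using inv by (simp add: invertible_ideal_def)
  then show "ideal (h ` I) S" by (rule ring.surj_image_ideal[OF surj])
  have Ic: "I \<subseteq> carrier R" using ideal.Icarr[OF I] by blast
  let ?K = "colon_ideal R (PIdl a) I"
  have "a \<in> I \<cdot> ?K" by (rule R.invertible_ideal_imp_colon[OF inv a])
  then have "h a \<in> (h ` I) \<cdot>\<^bsub>S\<^esub> (h ` ?K)"
    by (rule ring.ideal_prod_image[OF Ic, rotated]) (auto simp: colon_ideal_def)
  moreover have "h ` ?K \<subseteq> colon_ideal S (PIdl\<^bsub>S\<^esub> (h a)) (h ` I)"
    using ring.colon_ideal_image[OF Ic, of "PIdl a"]
    unfolding ring.surj_image_cgenideal[OF surj subsetD[OF Ic a]] .
  ultimately show "h a \<in> (h ` I) \<cdot>\<^bsub>S\<^esub> colon_ideal S (PIdl\<^bsub>S\<^esub> (h a)) (h ` I)"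
    by (rule subsetD[OF ideal_prod_mono, rotated])
qed


section \<open>Regular homomorphic images of Pruefer rings\<close>

theorem theorem4p3:
  fixes A :: "('a, 'm) ring_scheme" and B :: "('b, 'n) ring_scheme"
  assumes "pruefer_ring A" and "cring B" and "regular_hom_image B A"
  shows "pruefer_ring B"
proof -
  obtain f where hom: "f \<in> ring_hom A B" and surj: "f ` carrier A = carrier B"
    and reg: "\<And>a. a \<in> carrier A \<Longrightarrow> f a \<in> reg_elems B \<Longrightarrow> a \<in> reg_elems A"
    using assms(3) by (auto simp: regular_hom_image_def regular_morphism_def)
  interpret A: cring A using assms(1) by (simp add: pruefer_ring_def)
  interpret B: cring B by (rule assms(2))
  interpret f: ring_hom_cring A B f by unfold_locales (rule hom)
  have "invertible_ideal I B" if fg: "fin_gen_ideal I B" and rI: "regular_ideal I B" for I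
  proof -
    obtain S where S: "S \<subseteq> carrier B" "finite S" and I: "I = Idl\<^bsub>B\<^esub> S"
      using fg by (auto simp: fin_gen_ideal_def)
    obtain T where T: "T \<subseteq> carrier A" "finite T" and ST: "S = f ` T"
      using finite_subset_image[of S f "carrier A"] S surj by auto
    have fI: "I = f ` (Idl\<^bsub>A\<^esub> T)"
      unfolding I ST by (rule f.ring.surj_image_genideal[OF surj T(1), symmetric])
    obtain a where a: "a \<in> Idl\<^bsub>A\<^esub> T" and ra: "f a \<in> reg_elems B"
      using rI unfolding regular_ideal_def fI by blast
    have ideal: "ideal (Idl\<^bsub>A\<^esub> T) A" by (rule A.genideal_ideal[OF T(1)])
    have "a \<in> reg_elems A" using reg ideal.Icarr[OF ideal a] ra by blast
    then have "invertible_ideal (Idl\<^bsub>A\<^esub> T) A"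
      using assms(1) T a ideal unfolding pruefer_ring_def fin_gen_ideal_def regular_ideal_def
      by blast
    then show ?thesis
      unfolding fI using a ra by (rule f.surj_image_invertible_ideal[OF surj])
  qed
  then show ?thesis using assms(2) by (simp add: pruefer_ring_def)
qed

end
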